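(* Every pair $\Sigma=\{A_0,A_1\}\subset\{0,1\}^{2\times 2}$ of $2\times 2$ binary matrices has the finiteness property.
   Context: For a finite nonempty set $\Sigma\subset\mathbb{R}^{n\times n}$ and $t\ge 1$, let $\Sigma^t=\{A_1\cdots A_t : A_i\in\Sigma\}$ be the set of products of length $t$ of matrices from $\Sigma$. The joint spectral radius of $\Sigma$ is $\rho(\Sigma)=\limsup_{t\to\infty}\max\{\|A\|^{1/t}: A\in\Sigma^t\}$, which does not depend on the chosen matrix norm $\|\cdot\|$. For a single matrix $A$, $\rho(A)$ denotes its usual spectral radius. $\Sigma$ has the finiteness property if there exist $t\ge 1$ and a product $A\in\Sigma^t$ such that $\rho(\Sigma)=\rho(A)^{1/t}$. A binary matrix is a matrix with entries in $\{0,1\}$. *)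

theory Defs
  imports
    "HOL-Library.Extended_Real"
    "HOL-Library.Liminf_Limsup"
    "Jordan_Normal_Form.Spectral_Radius"
begin

definition mat_products :: "nat \<Rightarrow> real mat set \<Rightarrow> nat \<Rightarrow> real mat set" where
  "mat_products n S t = {foldr (*) As (1\<^sub>m n) | As. length As = t \<and> set As \<subseteq> S}"

(* The joint spectral radius does not depend on the matrix norm; the entrywise
   l1-norm is fixed here. *)
definition mat_norm :: "real mat \<Rightarrow> real" where
  "mat_norm A = (\<Sum>i<dim_row A. \<Sum>j<dim_col A. \<bar>A $$ (i, j)\<bar>)"

(* Meant for finite nonempty S \<subseteq> carrier_mat n n. The limsup is taken in the extended
   reals, where it always exists; the term at t = 0 has no influence on it. *)
definition joint_spectral_radius :: "nat \<Rightarrow> real mat set \<Rightarrow> ereal" where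
  "joint_spectral_radius n S =
     limsup (\<lambda>t. ereal (Max ((\<lambda>A. root t (mat_norm A)) ` mat_products n S t)))"

(* The eigenvalues of a real matrix are taken in the complex numbers. *)
definition finiteness_property :: "nat \<Rightarrow> real mat set \<Rightarrow> bool" where
  "finiteness_property n S \<longleftrightarrow>
     (\<exists>t\<ge>1. \<exists>A\<in>mat_products n S t.
        joint_spectral_radius n S = ereal (root t (spectral_radius (map_mat complex_of_real A))))"

definition binary_mats :: "nat \<Rightarrow> real mat set" where
  "binary_mats n = {A \<in> carrier_mat n n. elements_mat A \<subseteq> {0, 1}}"

end

(*
  For a set S of nonnegative matrices, a positive function f on the cone
  with f (A v) <= mu * f v for all A in S bounds the norms of all products
  of length t by a multiple of mu^t, so the joint spectral radius is at most mu.
  Conversely, every product P of length k satisfies rho(P)^(1/k) <= rho(S).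
  Hence it suffices to exhibit, for each pair of binary 2 x 2 matrices, a word
  with eigenvalue r^k and such functions f for all mu > r. The function is
  always a maximum of finitely many linear functionals, usually obtained by
  following an eigenfunctional of the optimal word. Only mu > r can be reached
  for triangular pairs, whose products may grow polynomially. Up to order and
  simultaneous permutation of the coordinates, a single matrix is an optimal
  word except for the two nilpotent matrix units (r = 1), the two shears
  (r = golden ratio), one pair with r^2 = 2, two pairs with r^3 = 3, one with
  r^5 = 4 and one with r^4 = (3 + sqrt 13) / 2.
*)

theory Submission
  imports Defs
begin

section \<open>The joint spectral radius\<close>

lemma foldr_mult_carrier:
  assumes "set As \<subseteq> carrier_mat n n"
  shows "foldr (*) As (1\<^sub>m n :: 'a :: semiring_1 mat) \<in> carrier_mat n n"
  using assms by (induction As) auto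

lemma foldr_mult_append:
  assumes "set As \<subseteq> carrier_mat n n" "set Bs \<subseteq> carrier_mat n n"
  shows "foldr (*) (As @ Bs) (1\<^sub>m n :: 'a :: semiring_1 mat)
    = foldr (*) As (1\<^sub>m n) * foldr (*) Bs (1\<^sub>m n)"
  using assms(1)
proof (induction As)
  case Nil
  then show ?case using foldr_mult_carrier[OF assms(2)] by simp
next
  case (Cons A As)
  then show ?case
    using foldr_mult_carrier[of As n] foldr_mult_carrier[OF assms(2)]
    by (simp add: assoc_mult_mat[of _ n n _ n _ n])
qed

lemma mat_products_pow:
  assumes S: "S \<subseteq> carrier_mat n n" and P: "P \<in> mat_products n S k"
  shows "P ^\<^sub>m m \<in> mat_products n S (m * k)"
proof -
  obtain As where As: "P = foldr (*) As (1\<^sub>m n)" "length As = k" "set As \<subseteq> S"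
    using P by (auto simp: mat_products_def)
  have c: "set As \<subseteq> carrier_mat n n" using As S by auto
  have dim: "dim_row P = n" using foldr_mult_carrier[OF c] As by auto
  have sub: "set (concat (replicate m As)) \<subseteq> set As" for m by auto
  \<comment> \<open>Matrix powers append a factor on the right, whereas \<open>replicate\<close>
    unfolds on the left.\<close>
  have comm: "concat (replicate m As) @ As = As @ concat (replicate m As)" for m
    by (induction m) auto
  have "P ^\<^sub>m m = foldr (*) (concat (replicate m As)) (1\<^sub>m n)" for m
  proof (induction m)
    case 0
    then show ?case using dim by simp
  next
    case (Suc m)
    have "P ^\<^sub>m Suc m = foldr (*) (concat (replicate m As) @ As) (1\<^sub>m n)"
      using Suc As(1) foldr_mult_append[OF subset_trans[OF sub c] c, of m] by simp
    then show ?case by (simp only: comm replicate_Suc concat.simps)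
  qed
  moreover have "length (concat (replicate m As)) = m * k"
    using As by (induction m) auto
  ultimately show ?thesis
    using As sub[of m] unfolding mat_products_def by blast
qed

lemma mat_products_carrier:
  assumes "S \<subseteq> carrier_mat n n" "P \<in> mat_products n S k"
  shows "P \<in> carrier_mat n n"
  using assms foldr_mult_carrier by (fastforce simp: mat_products_def)

lemma finite_mat_products: "finite S \<Longrightarrow> finite (mat_products n S t)"
proof -
  assume "finite S"
  then have "finite {As. set As \<subseteq> S \<and> length As = t}" by (rule finite_lists_length_eq)
  moreover have "mat_products n S t
    = (\<lambda>As. foldr (*) As (1\<^sub>m n)) ` {As. set As \<subseteq> S \<and> length As = t}"
    by (auto simp: mat_products_def)
  ultimately show ?thesis by simp
qed

text \<open>Take the l1-norm of both sides of \<open>A v = \<alpha> v\<close>. Bounding each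
  coordinate of \<open>v\<close> by the whole norm of \<open>v\<close> leaves the sum of the
  absolute entries of \<open>A\<close>; the norm of \<open>v\<close> is positive and
  cancels.\<close>

lemma norm_eigenvalue_le_mat_norm:
  assumes A: "A \<in> carrier_mat n n"
    and ev: "eigenvector (map_mat complex_of_real A) v \<alpha>"
  shows "norm \<alpha> \<le> mat_norm A"
proof -
  let ?s = "\<Sum>i<n. norm (v $ i)"
  have v: "v \<in> carrier_vec n" "v \<noteq> 0\<^sub>v n"
    and eq: "map_mat complex_of_real A *\<^sub>v v = \<alpha> \<cdot>\<^sub>v v"
    using ev A by (auto simp: eigenvector_def)
  obtain j where j: "j < n" "v $ j \<noteq> 0" using v by (metis carrier_vecD eq_vecI index_zero_vec)
  have le: "norm (v $ j) \<le> ?s" if "j < n" for j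
    using that by (intro member_le_sum) auto
  have pos: "?s > 0" using le[OF j(1)] j(2) by (smt (verit) zero_less_norm_iff)
  have "norm \<alpha> * ?s = (\<Sum>i<n. norm ((\<alpha> \<cdot>\<^sub>v v) $ i))"
    using v by (simp add: sum_distrib_left norm_mult)
  also have "\<dots> = (\<Sum>i<n. norm (\<Sum>j<n. complex_of_real (A $$ (i, j)) * v $ j))"
    unfolding eq[symmetric] using v A
    by (intro sum.cong refl arg_cong[of _ _ norm])
       (auto simp: scalar_prod_def lessThan_atLeast0 intro!: sum.cong)
  also have "\<dots> \<le> (\<Sum>i<n. \<Sum>j<n. \<bar>A $$ (i, j)\<bar> * norm (v $ j))"
    by (intro sum_mono order.trans[OF norm_sum]) (simp add: norm_mult)
  also have "\<dots> \<le> (\<Sum>i<n. \<Sum>j<n. \<bar>A $$ (i, j)\<bar> * ?s)"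
    by (intro sum_mono mult_left_mono le) auto
  also have "\<dots> = mat_norm A * ?s"
    using A by (simp add: mat_norm_def sum_distrib_right)
  finally show ?thesis using pos by simp
qed

text \<open>The powers of \<open>P\<close> are again products, with lengths that are multiples of
  \<open>k\<close>. An eigenvalue of maximal modulus bounds their norms from below, and the root of
  order \<open>m * k\<close> undoes the power \<open>m\<close>. So a subsequence of the terms under
  the limsup stays above the left-hand side.\<close>

lemma root_spectral_radius_le_joint_spectral_radius:
  assumes S: "S \<subseteq> carrier_mat n n" "finite S" and n: "n > 0" and k: "k \<ge> 1"
    and P: "P \<in> mat_products n S k"
  shows "ereal (root k (spectral_radius (map_mat complex_of_real P)))
    \<le> joint_spectral_radius n S"
proof -
  let ?C = "map_mat complex_of_real P"
  let ?r = "spectral_radius ?C"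
  let ?u = "\<lambda>t. ereal (Max ((\<lambda>A. root t (mat_norm A)) ` mat_products n S t))"
  have Pc: "P \<in> carrier_mat n n" using mat_products_carrier[OF S(1) P] .
  then have C: "?C \<in> carrier_mat n n" by simp
  obtain \<alpha> v where \<alpha>: "norm \<alpha> = ?r" and ev: "eigenvector ?C v \<alpha>"
    using spectral_radius_mem_max(1)[OF C n]
    by (auto simp: spectrum_def eigenvalue_def)
  \<comment> \<open>\<open>Suc m\<close> avoids length 0, where \<open>root 0\<close> is constantly
    0.\<close>
  have "ereal (root k ?r) \<le> ?u (Suc m * k)" for m
  proof -
    have r0: "?r \<ge> 0" using \<alpha> by (metis norm_ge_zero)
    have "eigenvector (?C ^\<^sub>m Suc m) v (\<alpha> ^ Suc m)"
      using eigenvector_pow[OF C ev, of "Suc m"] ev carrier_matD(1)[OF C]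
        carrier_matD(1)[OF pow_carrier_mat[OF C, of "Suc m"]]
      unfolding eigenvector_def by simp
    then have "eigenvector (map_mat complex_of_real (P ^\<^sub>m Suc m)) v (\<alpha> ^ Suc m)"
      by (simp only: of_real_hom.mat_hom_pow[OF Pc])
    then have "norm (\<alpha> ^ Suc m) \<le> mat_norm (P ^\<^sub>m Suc m)"
      by (rule norm_eigenvalue_le_mat_norm[OF pow_carrier_mat[OF Pc]])
    then have "?r ^ Suc m \<le> mat_norm (P ^\<^sub>m Suc m)"
      by (simp only: norm_power \<alpha>)
    then have "root (Suc m * k) (?r ^ Suc m) \<le> root (Suc m * k) (mat_norm (P ^\<^sub>m Suc m))"
      using k by (intro real_root_le_mono) auto
    moreover have "root (Suc m * k) (?r ^ Suc m) = root k ?r"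
      unfolding mult.commute[of "Suc m" k] real_root_mult_exp
      by (subst real_root_power_cancel) (use r0 in auto)
    moreover have "root (Suc m * k) (mat_norm (P ^\<^sub>m Suc m))
        \<le> Max ((\<lambda>A. root (Suc m * k) (mat_norm A)) ` mat_products n S (Suc m * k))"
      using mat_products_pow[OF S(1) P, of "Suc m"] finite_mat_products[OF S(2)]
      by (intro Max_ge) auto
    ultimately show ?thesis by simp
  qed
  then have "ereal (root k ?r) \<le> limsup (?u \<circ> (\<lambda>m. Suc m * k))"
    by (intro le_Limsup[OF sequentially_bot] always_eventually) simp
  also have "\<dots> \<le> limsup ?u"
    using k by (intro limsup_subseq_mono) (auto simp: strict_mono_def)
  finally show ?thesis unfolding joint_spectral_radius_def .
qed

text \<open>The constant \<open>C\<close> is invisible in the limit because \<open>root t C\<close>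
  tends to 1.\<close>

lemma joint_spectral_radius_le:
  assumes S: "finite S" "S \<noteq> {}" and \<mu>: "\<mu> \<ge> 0" and C: "C > 0"
    and bound: "\<And>t A. A \<in> mat_products n S t \<Longrightarrow> mat_norm A \<le> C * \<mu> ^ t"
  shows "joint_spectral_radius n S \<le> ereal \<mu>"
proof -
  have ne: "mat_products n S t \<noteq> {}" for t
  proof -
    obtain A where "A \<in> S" using S by auto
    then have "foldr (*) (replicate t A) (1\<^sub>m n) \<in> mat_products n S t"
      unfolding mat_products_def by fastforce
    then show ?thesis by auto
  qed
  have "Max ((\<lambda>A. root t (mat_norm A)) ` mat_products n S t) \<le> root t C * \<mu>" if "t \<ge> 1" for t
  proof -
    have "root t (mat_norm A) \<le> root t C * \<mu>" if A: "A \<in> mat_products n S t" for A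
    proof -
      have "root t (mat_norm A) \<le> root t (C * \<mu> ^ t)"
        using \<open>t \<ge> 1\<close> bound[OF A] by (intro real_root_le_mono) auto
      also have "\<dots> = root t C * \<mu>"
        using \<open>t \<ge> 1\<close> \<mu> by (simp add: real_root_mult real_root_power_cancel)
      finally show ?thesis .
    qed
    then show ?thesis using ne finite_mat_products[OF S(1)] by (subst Max_le_iff) auto
  qed
  then have "joint_spectral_radius n S \<le> limsup (\<lambda>t. ereal (root t C * \<mu>))"
    unfolding joint_spectral_radius_def
    by (intro Limsup_mono) (auto simp: eventually_sequentially)
  also have "\<dots> = ereal \<mu>"
  proof (rule lim_imp_Limsup[OF sequentially_bot])
    have "(\<lambda>t. ereal (root t C * \<mu>)) \<longlonglongrightarrow> ereal (1 * \<mu>)"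
      by (intro tendsto_ereal tendsto_mult LIMSEQ_root_const C tendsto_const)
    then show "(\<lambda>t. ereal (root t C * \<mu>)) \<longlonglongrightarrow> ereal \<mu>" by simp
  qed
  finally show ?thesis .
qed

section \<open>Certificates for sets of nonnegative matrices of size two\<close>

definition mat2 :: "real \<Rightarrow> real \<Rightarrow> real \<Rightarrow> real \<Rightarrow> real mat" where
  "mat2 a b c d = mat_of_rows_list 2 [[a, b], [c, d]]"

lemma mat2_carrier [simp]: "mat2 a b c d \<in> carrier_mat 2 2"
  by (simp add: mat2_def mat_of_rows_list_def numeral_2_eq_2)

lemma mat2_index [simp]:
  "mat2 a b c d $$ (0, 0) = a" "mat2 a b c d $$ (0, Suc 0) = b"
  "mat2 a b c d $$ (Suc 0, 0) = c" "mat2 a b c d $$ (Suc 0, Suc 0) = d"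
  by (simp_all add: mat2_def mat_of_rows_list_def numeral_2_eq_2)

lemma mat2_eta:
  assumes "A \<in> carrier_mat 2 2"
  shows "A = mat2 (A $$ (0, 0)) (A $$ (0, 1)) (A $$ (1, 0)) (A $$ (1, 1))" (is "A = ?B")
proof (rule eq_matI)
  have c: "?B \<in> carrier_mat 2 2" by simp
  show "dim_row A = dim_row ?B" "dim_col A = dim_col ?B" using assms carrier_matD[OF c] by simp_all
  fix i j assume "i < dim_row ?B" "j < dim_col ?B"
  then show "A $$ (i, j) = ?B $$ (i, j)"
    using carrier_matD[OF c] by (auto simp: less_2_cases_iff)
qed

definition col_act :: "real mat \<Rightarrow> real \<times> real \<Rightarrow> real \<times> real" where
  "col_act A v = (A $$ (0, 0) * fst v + A $$ (0, 1) * snd v, A $$ (1, 0) * fst v + A $$ (1, 1) * snd v)"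

text \<open>The pair \<open>w\<close> represents a linear functional, and this action is composition
  with \<open>A\<close>, dual to \<open>col_act\<close>.\<close>

definition row_act :: "real mat \<Rightarrow> real \<times> real \<Rightarrow> real \<times> real" where
  "row_act A w = (fst w * A $$ (0, 0) + snd w * A $$ (1, 0), fst w * A $$ (0, 1) + snd w * A $$ (1, 1))"

lemma act_mat2 [simp]:
  "col_act (mat2 a b c d) (x, y) = (a * x + b * y, c * x + d * y)"
  "row_act (mat2 a b c d) (p, q) = (p * a + q * c, p * b + q * d)"
  by (simp_all add: col_act_def row_act_def)

lemma col_act_foldr:
  assumes "set As \<subseteq> carrier_mat 2 2"
  shows "col_act (foldr (*) As (1\<^sub>m 2)) v = foldr col_act As v"
  using assms
proof (induction As)
  case Nil
  then show ?case by (simp add: col_act_def)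
next
  case (Cons A As)
  let ?P = "foldr (*) As (1\<^sub>m 2)"
  have "?P \<in> carrier_mat 2 2" using Cons.prems foldr_mult_carrier[of As 2] by simp
  then have "col_act (A * ?P) v = col_act A (col_act ?P v)"
    using Cons.prems
    by (auto simp: col_act_def scalar_prod_def numeral_2_eq_2 algebra_simps)
  then show ?case using Cons by simp
qed

definition nonneg_mats :: "real mat set \<Rightarrow> bool" where
  "nonneg_mats S \<longleftrightarrow> S \<subseteq> carrier_mat 2 2 \<and> (\<forall>A\<in>S. \<forall>i<2. \<forall>j<2. A $$ (i, j) \<ge> 0)"

text \<open>\<open>f\<close> acts as a norm on the nonnegative quadrant adapted to \<open>S\<close>.
  Comparison with the l1-norm from below suffices, since growth is measured from the two unit
  vectors only.\<close>

definition growth_bound :: "real mat set \<Rightarrow> real \<Rightarrow> bool" where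
  "growth_bound S \<mu> \<longleftrightarrow> (\<exists>f c. c > 0 \<and> (\<forall>x\<ge>0. \<forall>y\<ge>0. c * (x + y) \<le> f (x, y)) \<and>
     (\<forall>A\<in>S. \<forall>x\<ge>0. \<forall>y\<ge>0. f (col_act A (x, y)) \<le> \<mu> * f (x, y)))"

lemma growth_bound_mono:
  assumes "growth_bound S \<mu>" "\<mu> \<le> \<nu>"
  shows "growth_bound S \<nu>"
proof -
  obtain f c where f: "c > 0" "\<forall>x\<ge>0. \<forall>y\<ge>0. c * (x + y) \<le> f (x, y)"
    "\<forall>A\<in>S. \<forall>x\<ge>0. \<forall>y\<ge>0. f (col_act A (x, y)) \<le> \<mu> * f (x, y)"
    using assms(1) unfolding growth_bound_def by blast
  have "f (x, y) \<ge> 0" if "x \<ge> 0" "y \<ge> 0" for x y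
    using f(1,2) that by (meson add_nonneg_nonneg less_imp_le mult_nonneg_nonneg order_trans)
  then have "\<forall>A\<in>S. \<forall>x\<ge>0. \<forall>y\<ge>0. f (col_act A (x, y)) \<le> \<nu> * f (x, y)"
    using f(3) assms(2) by (meson mult_right_mono order_trans)
  then show ?thesis using f(1,2) unfolding growth_bound_def by blast
qed

text \<open>The columns of a product are the images of the unit vectors. They stay in the quadrant,
  so \<open>f\<close> can be iterated along the word, and the norm of a nonnegative matrix is the
  sum of its two columns' coordinate sums.\<close>

lemma growth_bound_products:
  assumes S: "nonneg_mats S" and gb: "growth_bound S \<mu>" and \<mu>: "\<mu> \<ge> 0"
  obtains C where "C > 0" "\<And>t A. A \<in> mat_products 2 S t \<Longrightarrow> mat_norm A \<le> C * \<mu> ^ t"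
proof -
  obtain f c where f: "c > 0" "\<And>x y. x \<ge> 0 \<Longrightarrow> y \<ge> 0 \<Longrightarrow> c * (x + y) \<le> f (x, y)"
    "\<And>A x y. A \<in> S \<Longrightarrow> x \<ge> 0 \<Longrightarrow> y \<ge> 0 \<Longrightarrow> f (col_act A (x, y)) \<le> \<mu> * f (x, y)"
    using gb unfolding growth_bound_def by blast
  have word: "fst (foldr col_act As (x, y)) \<ge> 0 \<and> snd (foldr col_act As (x, y)) \<ge> 0 \<and>
      f (foldr col_act As (x, y)) \<le> \<mu> ^ length As * f (x, y)"
    if "set As \<subseteq> S" "x \<ge> 0" "y \<ge> 0" for As x y
    using that(1)
  proof (induction As)
    case Nil
    then show ?case using that by simp
  next
    case (Cons A As)
    obtain x' y' where xy: "foldr col_act As (x, y) = (x', y')" by fastforce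
    then have nn: "x' \<ge> 0" "y' \<ge> 0" and le: "f (x', y') \<le> \<mu> ^ length As * f (x, y)"
      using Cons by auto
    have "fst (col_act A (x', y')) \<ge> 0" "snd (col_act A (x', y')) \<ge> 0"
      using S Cons.prems nn by (auto simp: col_act_def nonneg_mats_def)
    moreover have "f (col_act A (x', y')) \<le> \<mu> * f (x', y')"
      using f(3) Cons.prems nn by simp
    moreover have "\<dots> \<le> \<mu> * (\<mu> ^ length As * f (x, y))"
      using le \<mu> by (rule mult_left_mono)
    ultimately show ?case by (simp add: xy mult.assoc)
  qed
  let ?K = "f (1, 0) + f (0, 1)"
  have "mat_norm A \<le> ?K / c * \<mu> ^ t" if A: "A \<in> mat_products 2 S t" for t A
  proof -
    obtain As where As: "A = foldr (*) As (1\<^sub>m 2)" "length As = t" "set As \<subseteq> S"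
      using A by (auto simp: mat_products_def)
    have S2: "S \<subseteq> carrier_mat 2 2" using S by (simp add: nonneg_mats_def)
    then have c: "A \<in> carrier_mat 2 2" using mat_products_carrier A by blast
    have act: "foldr col_act As v = col_act A v" for v
      using col_act_foldr[of As v] As S2 by auto
    have w1: "A $$ (0, 0) \<ge> 0" "A $$ (1, 0) \<ge> 0" "f (A $$ (0, 0), A $$ (1, 0)) \<le> \<mu> ^ t * f (1, 0)"
      using word[OF As(3), of 1 0] As(2) unfolding act by (auto simp: col_act_def)
    have w2: "A $$ (0, 1) \<ge> 0" "A $$ (1, 1) \<ge> 0" "f (A $$ (0, 1), A $$ (1, 1)) \<le> \<mu> ^ t * f (0, 1)"
      using word[OF As(3), of 0 1] As(2) unfolding act by (auto simp: col_act_def)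
    have "mat_norm A = (A $$ (0, 0) + A $$ (1, 0)) + (A $$ (0, 1) + A $$ (1, 1))"
      using c w1 w2 by (simp add: mat_norm_def numeral_2_eq_2)
    then have "c * mat_norm A \<le> \<mu> ^ t * ?K"
      using f(2)[OF w1(1,2)] f(2)[OF w2(1,2)] w1(3) w2(3) by (simp add: distrib_left)
    then show ?thesis using f(1) by (simp add: field_simps)
  qed
  moreover have "?K / c > 0" using f(1) f(2)[of 1 0] f(2)[of 0 1] by simp
  ultimately show ?thesis using that by blast
qed

section \<open>Maxima of linear functionals as certificates\<close>

text \<open>On the quadrant this makes the functional \<open>w\<close> at most \<mu> times the
  maximum of the functionals in \<open>W\<close>. Two members suffice in the plane, where the upper
  right boundary of a convex hull consists of edges.\<close>

definition below :: "real \<Rightarrow> (real \<times> real) set \<Rightarrow> real \<times> real \<Rightarrow> bool" where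
  "below \<mu> W w \<longleftrightarrow> (\<exists>u\<in>W. \<exists>v\<in>W. \<exists>s. 0 \<le> s \<and> s \<le> 1 \<and>
     fst w \<le> \<mu> * (s * fst u + (1 - s) * fst v) \<and> snd w \<le> \<mu> * (s * snd u + (1 - s) * snd v))"

lemma belowI:
  assumes "(p', q') \<in> W" "p \<le> \<mu> * p'" "q \<le> \<mu> * q'"
  shows "below \<mu> W (p, q)"
  unfolding below_def using assms
  by (intro bexI[of _ "(p', q')"] exI[of _ 1]) auto

text \<open>The weights encode \<open>s = k / (k + l)\<close>, so that concrete instances are free
  of division.\<close>

lemma below_convexI:
  assumes "(a, b) \<in> W" "(a', b') \<in> W" "0 \<le> k" "0 \<le> l" "0 < k + l"
    and "(k + l) * p \<le> k * (\<mu> * a) + l * (\<mu> * a')" "(k + l) * q \<le> k * (\<mu> * b) + l * (\<mu> * b')"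
  shows "below \<mu> W (p, q)"
proof -
  have scale: "x \<le> \<mu> * (k / (k + l) * y + (1 - k / (k + l)) * z)"
    if "(k + l) * x \<le> k * (\<mu> * y) + l * (\<mu> * z)" for x y z
  proof -
    have eq: "1 - k / (k + l) = l / (k + l)" using assms(5) by (simp add: field_simps)
    have "\<mu> * (k / (k + l) * y + l / (k + l) * z) = (k * (\<mu> * y) + l * (\<mu> * z)) / (k + l)"
      by (simp add: add_divide_distrib distrib_left mult.left_commute)
    then show ?thesis using that assms(5) unfolding eq by (simp add: pos_le_divide_eq mult.commute)
  qed
  show ?thesis
    unfolding below_def using assms(1-5) scale[OF assms(6)] scale[OF assms(7)]
    by (intro bexI[of _ "(a, b)"] bexI[of _ "(a', b')"] exI[of _ "k / (k + l)"]) auto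
qed

text \<open>The function is the maximum over \<open>W\<close>. By duality, evaluating
  \<open>w\<close> at \<open>A v\<close> equals evaluating \<open>row_act A w\<close> at
  \<open>v\<close>, which turns the growth condition into finitely many comparisons of
  functionals.\<close>

lemma growth_boundI:
  assumes W: "finite W" and \<mu>: "\<mu> \<ge> 0"
    and nn: "\<And>p q. (p, q) \<in> W \<Longrightarrow> p \<ge> 0 \<and> q \<ge> 0"
    and pos: "(p1, q1) \<in> W" "p1 > 0" "(p2, q2) \<in> W" "q2 > 0"
    and step: "\<And>A w. A \<in> S \<Longrightarrow> w \<in> W \<Longrightarrow> below \<mu> W (row_act A w)"
  shows "growth_bound S \<mu>"
proof -
  let ?ev = "\<lambda>v w :: real \<times> real. fst w * fst v + snd w * snd v"
  define f where "f v = Max (?ev v ` W)" for v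
  have ge: "?ev v w \<le> f v" if "w \<in> W" for v w
    unfolding f_def using W that by (intro Max_ge) auto
  \<comment> \<open>\<open>f\<close> dominates both \<open>p1 * x\<close> and \<open>q2 * y\<close>,
    hence also their mean.\<close>
  define c where "c = min p1 q2 / 2"
  have "c > 0" using pos by (simp add: c_def)
  moreover have "c * (x + y) \<le> f (x, y)" if "x \<ge> 0" "y \<ge> 0" for x y
  proof -
    have "p1 * x \<le> f (x, y)" "q2 * y \<le> f (x, y)"
      using ge[OF pos(1), of "(x, y)"] ge[OF pos(3), of "(x, y)"]
        mult_nonneg_nonneg[of q1 y] mult_nonneg_nonneg[of p2 x] nn pos that by fastforce+
    moreover have "min p1 q2 * x \<le> p1 * x" "min p1 q2 * y \<le> q2 * y"
      using that by (auto intro!: mult_right_mono)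
    ultimately show ?thesis by (simp add: c_def distrib_left)
  qed
  moreover have "f (col_act A (x, y)) \<le> \<mu> * f (x, y)" if A: "A \<in> S" and xy: "x \<ge> 0" "y \<ge> 0" for A x y
  proof -
    have "?ev (col_act A (x, y)) w \<le> \<mu> * f (x, y)" if w: "w \<in> W" for w
    proof -
      obtain u v s where uv: "u \<in> W" "v \<in> W" and s: "0 \<le> s" "s \<le> 1"
        and le: "fst (row_act A w) \<le> \<mu> * (s * fst u + (1 - s) * fst v)"
          "snd (row_act A w) \<le> \<mu> * (s * snd u + (1 - s) * snd v)"
        using step[OF A w] unfolding below_def by blast
      have "?ev (col_act A (x, y)) w = fst (row_act A w) * x + snd (row_act A w) * y"
        by (simp add: col_act_def row_act_def algebra_simps)
      also have "\<dots> \<le> \<mu> * (s * fst u + (1 - s) * fst v) * x + \<mu> * (s * snd u + (1 - s) * snd v) * y"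
        using le xy by (intro add_mono mult_right_mono)
      also have "\<dots> = \<mu> * (s * ?ev (x, y) u + (1 - s) * ?ev (x, y) v)"
        by (simp add: algebra_simps)
      also have "\<dots> \<le> \<mu> * (s * f (x, y) + (1 - s) * f (x, y))"
        using s \<mu> by (intro mult_left_mono add_mono ge uv) auto
      finally show ?thesis by (simp add: algebra_simps)
    qed
    moreover have "W \<noteq> {}" using pos by auto
    ultimately show ?thesis
      using W unfolding f_def[of "col_act A (x, y)"] by (subst Max_le_iff) auto
  qed
  ultimately show ?thesis unfolding growth_bound_def by blast
qed

section \<open>Optimal words and extremal sets\<close>

definition attains :: "real mat set \<Rightarrow> real \<Rightarrow> bool" where
  "attains S \<rho> \<longleftrightarrow> (\<exists>As x y. As \<noteq> [] \<and> set As \<subseteq> S \<and> (x, y) \<noteq> (0, 0) \<and>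
     foldr col_act As (x, y) = (\<rho> ^ length As * x, \<rho> ^ length As * y))"

definition extremal :: "real mat set \<Rightarrow> bool" where
  "extremal S \<longleftrightarrow> (\<exists>\<rho>\<ge>0. attains S \<rho> \<and> (\<forall>\<mu>>\<rho>. growth_bound S \<mu>))"

lemma extremalI: "\<rho> \<ge> 0 \<Longrightarrow> attains S \<rho> \<Longrightarrow> growth_bound S \<rho> \<Longrightarrow> extremal S"
  unfolding extremal_def using growth_bound_mono less_imp_le by blast

lemma attains_word:
  assumes "foldr col_act As (x, y) = (\<rho> ^ length As * x, \<rho> ^ length As * y)"
    "As \<noteq> []" "set As \<subseteq> S" "x \<noteq> 0 \<or> y \<noteq> 0"
  shows "attains S \<rho>"
  unfolding attains_def using assms by blast

text \<open>For the attaining word, of length \<open>k\<close> and product \<open>P\<close>, this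
  closes the circle \<rho> \<le> \<open>root k\<close> of the spectral radius of \<open>P\<close>
  \<le> joint spectral radius \<le> \<rho>. That \<rho>\<open>^k\<close> is the dominant eigenvalue
  of \<open>P\<close> is a consequence, not an assumption.\<close>

lemma finiteness_property_if_extremal:
  assumes S: "nonneg_mats S" "finite S" and ex: "extremal S"
  shows "finiteness_property 2 S"
proof -
  obtain \<rho> where \<rho>: "\<rho> \<ge> 0" "attains S \<rho>" and gb: "\<And>\<mu>. \<mu> > \<rho> \<Longrightarrow> growth_bound S \<mu>"
    using ex unfolding extremal_def by blast
  then obtain As x y where As: "As \<noteq> []" "set As \<subseteq> S" and xy: "(x, y) \<noteq> (0, 0)"
    and ev: "foldr col_act As (x, y) = (\<rho> ^ length As * x, \<rho> ^ length As * y)"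
    unfolding attains_def by blast
  define k where "k = length As"
  define P where "P = foldr (*) As (1\<^sub>m 2 :: real mat)"
  have k: "k \<ge> 1" using As by (cases As) (auto simp: k_def)
  have S2: "S \<subseteq> carrier_mat 2 2" using S by (simp add: nonneg_mats_def)
  have P: "P \<in> mat_products 2 S k" using As by (auto simp: P_def k_def mat_products_def)
  have Pc: "P \<in> carrier_mat 2 2" using mat_products_carrier[OF S2 P] .
  let ?C = "map_mat complex_of_real P"
  have C: "?C \<in> carrier_mat 2 2" using Pc by simp
  let ?v = "vec_of_list [complex_of_real x, complex_of_real y]"
  have act: "col_act P (x, y) = (\<rho> ^ k * x, \<rho> ^ k * y)"
    using ev col_act_foldr[of As "(x, y)"] As S2 by (auto simp: P_def k_def)
  have v: "?v \<in> carrier_vec 2" by (simp add: carrier_vecI numeral_2_eq_2)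
  have "?v \<noteq> 0\<^sub>v 2"
  proof
    assume z: "?v = 0\<^sub>v 2"
    have "?v $ 0 = 0" "?v $ 1 = 0" by (simp_all only: z) simp_all
    then show False using xy by simp
  qed
  moreover have "?C *\<^sub>v ?v = complex_of_real (\<rho> ^ k) \<cdot>\<^sub>v ?v"
  proof (rule eq_vecI)
    fix i assume "i < dim_vec (complex_of_real (\<rho> ^ k) \<cdot>\<^sub>v ?v)"
    then have i: "i = 0 \<or> i = 1" by auto
    have "complex_of_real (P $$ (0, 0)) * x + complex_of_real (P $$ (0, 1)) * y = of_real (\<rho> ^ k * x)"
      "complex_of_real (P $$ (1, 0)) * x + complex_of_real (P $$ (1, 1)) * y = of_real (\<rho> ^ k * y)"
      using act unfolding col_act_def by (simp_all flip: of_real_mult of_real_add)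
    then show "(?C *\<^sub>v ?v) $ i = (complex_of_real (\<rho> ^ k) \<cdot>\<^sub>v ?v) $ i"
      using i Pc by (auto simp: scalar_prod_def numeral_2_eq_2)
  qed (use Pc in \<open>simp add: numeral_2_eq_2\<close>)
  ultimately have "complex_of_real (\<rho> ^ k) \<in> spectrum ?C"
    using v C unfolding spectrum_def eigenvalue_def eigenvector_def by auto
  then have "norm (complex_of_real (\<rho> ^ k)) \<le> spectral_radius ?C"
    using spectral_radius_mem_max(2)[OF C] by auto
  then have "\<rho> ^ k \<le> spectral_radius ?C" using \<rho>(1) by (simp add: norm_power)
  then have "root k (\<rho> ^ k) \<le> root k (spectral_radius ?C)"
    using k by (intro real_root_le_mono) auto
  then have "\<rho> \<le> root k (spectral_radius ?C)"
    using \<rho>(1) k by (simp add: real_root_power_cancel)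
  moreover have "joint_spectral_radius 2 S \<le> ereal \<rho>"
  proof (rule ereal_le_epsilon2)
    fix e :: real assume "0 < e"
    then have gb': "growth_bound S (\<rho> + e)" "\<rho> + e \<ge> 0" using gb \<rho>(1) by auto
    obtain K where K: "K > 0" "\<And>t A. A \<in> mat_products 2 S t \<Longrightarrow> mat_norm A \<le> K * (\<rho> + e) ^ t"
      using growth_bound_products[OF S(1) gb'] by blast
    have "S \<noteq> {}" using As by auto
    from joint_spectral_radius_le[OF S(2) this gb'(2) K]
    show "joint_spectral_radius 2 S \<le> ereal \<rho> + ereal e" by simp
  qed
  moreover have "ereal (root k (spectral_radius ?C)) \<le> joint_spectral_radius 2 S"
    using root_spectral_radius_le_joint_spectral_radius[OF S2 S(2) _ k P] by simp
  ultimately have "joint_spectral_radius 2 S = ereal (root k (spectral_radius ?C))"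
    by (meson antisym ereal_less_eq(3) order_trans)
  then show ?thesis unfolding finiteness_property_def using k P by blast
qed

section \<open>Exchange of the two coordinates\<close>

definition flip :: "real mat \<Rightarrow> real mat" where
  "flip A = mat2 (A $$ (1, 1)) (A $$ (1, 0)) (A $$ (0, 1)) (A $$ (0, 0))"

lemma flip_mat2 [simp]: "flip (mat2 a b c d) = mat2 d c b a"
  by (simp add: flip_def)

lemma col_act_flip: "col_act (flip A) v = prod.swap (col_act A (prod.swap v))"
  by (simp add: flip_def col_act_def)

text \<open>\<open>flip\<close> is conjugation by the permutation matrix, so eigenvectors and growth
  functions are transported by \<open>prod.swap\<close>.\<close>

lemma extremal_flip:
  assumes "extremal S"
  shows "extremal (flip ` S)"
proof -
  obtain \<rho> where \<rho>: "\<rho> \<ge> 0" "attains S \<rho>" and gb: "\<And>\<mu>. \<mu> > \<rho> \<Longrightarrow> growth_bound S \<mu>"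
    using assms unfolding extremal_def by blast
  have word: "foldr col_act (map flip As) v = prod.swap (foldr col_act As (prod.swap v))" for As v
    by (induction As) (auto simp: col_act_flip)
  have "attains (flip ` S) \<rho>"
  proof -
    obtain As x y where As: "As \<noteq> []" "set As \<subseteq> S" "(x, y) \<noteq> (0, 0)"
      "foldr col_act As (x, y) = (\<rho> ^ length As * x, \<rho> ^ length As * y)"
      using \<rho>(2) unfolding attains_def by blast
    have "foldr col_act (map flip As) (y, x)
        = (\<rho> ^ length (map flip As) * y, \<rho> ^ length (map flip As) * x)"
      using As unfolding word by simp
    then show ?thesis
      by (rule attains_word) (use As in auto)
  qed
  moreover have "growth_bound (flip ` S) \<mu>" if \<mu>: "\<mu> > \<rho>" for \<mu>
  proof -
    obtain f c where f: "c > 0" "\<forall>x\<ge>0. \<forall>y\<ge>0. c * (x + y) \<le> f (x, y)"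
      "\<forall>A\<in>S. \<forall>x\<ge>0. \<forall>y\<ge>0. f (col_act A (x, y)) \<le> \<mu> * f (x, y)"
      using gb[OF \<mu>] unfolding growth_bound_def by blast
    moreover have "\<forall>x\<ge>0. \<forall>y\<ge>0. c * (x + y) \<le> f (y, x)"
      using f(2) by (metis add.commute)
    ultimately show ?thesis
      unfolding growth_bound_def
      by (intro exI[of _ "\<lambda>v. f (prod.swap v)"] exI[of _ c])
         (use f in \<open>auto simp: col_act_flip\<close>)
  qed
  ultimately show ?thesis using \<rho>(1) unfolding extremal_def by blast
qed

section \<open>Pairs of binary matrices\<close>

definition extremal_pair :: "real mat \<Rightarrow> real mat \<Rightarrow> bool" where
  "extremal_pair A B \<longleftrightarrow> extremal {A, B}"

lemma extremal_pair_commute: "extremal_pair A B \<Longrightarrow> extremal_pair B A"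
  by (simp add: extremal_pair_def insert_commute)

lemma extremal_pair_flip:
  assumes "extremal_pair (mat2 a b c d) (mat2 a' b' c' d')"
  shows "extremal_pair (mat2 d c b a) (mat2 d' c' b' a')"
  using extremal_flip[of "{mat2 a b c d, mat2 a' b' c' d'}"] assms
  by (simp add: extremal_pair_def)

lemma extremal_pairI:
  assumes "\<rho> \<ge> 0" "attains {A, B} \<rho>" "growth_bound {A, B} \<rho>"
  shows "extremal_pair A B"
  using assms unfolding extremal_pair_def by (rule extremalI)

section \<open>Families with integer joint spectral radius\<close>

text \<open>The eigenvalue 1 sits on the diagonal, with eigenvector \<open>(1, 0)\<close> if
  \<open>a = 1\<close> and \<open>(b, 1)\<close> otherwise.\<close>

lemma attains_one_upper:
  assumes "mat2 a b 0 d \<in> S" "a = 1 \<or> a = 0 \<and> d = 1"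
  shows "attains S 1"
proof (cases "a = 1")
  case True
  then show ?thesis by (intro attains_word[of "[mat2 a b 0 d]" 1 0]) (use assms in auto)
next
  case False
  then show ?thesis by (intro attains_word[of "[mat2 a b 0 d]" b 1]) (use assms in auto)
qed

lemma attains_one_lower:
  assumes "mat2 a 0 c d \<in> S" "d = 1 \<or> d = 0 \<and> a = 1"
  shows "attains S 1"
proof (cases "d = 1")
  case True
  then show ?thesis by (intro attains_word[of "[mat2 a 0 c d]" 0 1]) (use assms in auto)
next
  case False
  then show ?thesis by (intro attains_word[of "[mat2 a 0 c d]" 1 c]) (use assms in auto)
qed

lemma attains_one_swap: "mat2 0 1 1 0 \<in> S \<Longrightarrow> attains S 1"
  by (intro attains_word[of "[mat2 0 1 1 0]" 1 1]) auto

lemma attains_one_nilpotent: "mat2 0 1 0 0 \<in> S \<Longrightarrow> mat2 0 0 1 0 \<in> S \<Longrightarrow> attains S 1"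
  by (intro attains_word[of "[mat2 0 1 0 0, mat2 0 0 1 0]" 1 0]) auto

text \<open>Products of upper triangular matrices multiply the diagonals, so the largest diagonal
  entry is the value to reach.\<close>

lemma extremal_pair_upper:
  assumes bin: "a \<in> {0, 1}" "b \<in> {0, 1}" "d \<in> {0, 1}" "a' \<in> {0, 1}" "b' \<in> {0, 1}" "d' \<in> {0, 1}"
  shows "extremal_pair (mat2 a b 0 d) (mat2 a' b' 0 d')" (is "extremal_pair ?A ?B")
proof -
  define \<rho> :: real where "\<rho> = max (max a d) (max a' d')"
  have \<rho>: "\<rho> = 0 \<or> \<rho> = 1" "\<rho> \<ge> 0" using bin by (auto simp: \<rho>_def)
  have "attains {?A, ?B} \<rho>"
  proof (cases "\<rho> = 0")
    case True
    then have "a = 0" using bin by (auto simp: \<rho>_def)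
    then show ?thesis using True by (intro attains_word[of "[?A]" 1 0]) auto
  next
    case False
    then consider "a = 1 \<or> a = 0 \<and> d = 1" | "a' = 1 \<or> a' = 0 \<and> d' = 1"
      using bin by (auto simp: \<rho>_def)
    then have "attains {?A, ?B} 1"
      using attains_one_upper[of a b d "{?A, ?B}"] attains_one_upper[of a' b' d' "{?A, ?B}"]
      by cases auto
    then show ?thesis using False \<rho> by simp
  qed
  \<comment> \<open>The small weight \<mu> - \<rho> on the first coordinate absorbs the off-diagonal
    entry: it adds at most \<mu> - \<rho> to a diagonal entry of at most \<rho>. At \<mu> = \<rho>
    the weight would vanish.\<close>
  moreover have "growth_bound {?A, ?B} \<mu>" if \<mu>: "\<mu> > \<rho>" for \<mu>
  proof (rule growth_boundI[where W = "{(\<mu> - \<rho>, 1)}"])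
    fix A w assume A: "A \<in> {?A, ?B}" and w: "w \<in> {(\<mu> - \<rho>, 1 :: real)}"
    have step: "below \<mu> {(\<mu> - \<rho>, 1)} (row_act (mat2 p q 0 r) (\<mu> - \<rho>, 1))"
      if "p \<le> \<rho>" "q \<le> 1" "r \<le> \<rho>" for p q r
    proof -
      have "(\<mu> - \<rho>) * p \<le> (\<mu> - \<rho>) * \<mu>" "(\<mu> - \<rho>) * q \<le> (\<mu> - \<rho>) * 1"
        using that \<mu> by (intro mult_left_mono; simp)+
      then show ?thesis using that
        by (simp, intro belowI[of "\<mu> - \<rho>" 1]) (simp_all add: mult.commute)
    qed
    have "a \<le> \<rho>" "b \<le> 1" "d \<le> \<rho>" "a' \<le> \<rho>" "b' \<le> 1" "d' \<le> \<rho>"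
      using bin by (auto simp: \<rho>_def)
    then show "below \<mu> {(\<mu> - \<rho>, 1)} (row_act A w)"
      using A w step by blast
  qed (use \<mu> \<rho>(2) in auto)
  ultimately show ?thesis
    unfolding extremal_pair_def extremal_def using \<rho>(2) by blast
qed

lemma extremal_pair_lower:
  assumes "a \<in> {0, 1}" "c \<in> {0, 1}" "d \<in> {0, 1}" "a' \<in> {0, 1}" "c' \<in> {0, 1}" "d' \<in> {0, 1}"
  shows "extremal_pair (mat2 a 0 c d) (mat2 a' 0 c' d')"
  by (rule extremal_pair_flip[OF extremal_pair_upper]) (use assms in auto)

text \<open>The coordinate sum does not grow.\<close>

lemma extremal_pair_column_sums:
  assumes "a + c \<le> 1" "b + d \<le> 1" "a' + c' \<le> 1" "b' + d' \<le> 1"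
    and "attains {mat2 a b c d, mat2 a' b' c' d'} 1"
  shows "extremal_pair (mat2 a b c d) (mat2 a' b' c' d')"
proof (rule extremal_pairI)
  show "growth_bound {mat2 a b c d, mat2 a' b' c' d'} 1"
    by (rule growth_boundI[where W = "{(1, 1)}"]) (use assms in \<open>auto intro!: belowI[of 1 1]\<close>)
qed (use assms in auto)

text \<open>The maximum of the two coordinates does not grow.\<close>

lemma extremal_pair_row_sums:
  assumes nn: "a \<ge> 0" "b \<ge> 0" "c \<ge> 0" "d \<ge> 0" "a' \<ge> 0" "b' \<ge> 0" "c' \<ge> 0" "d' \<ge> 0"
    and le: "a + b \<le> 1" "c + d \<le> 1" "a' + b' \<le> 1" "c' + d' \<le> 1"
    and att: "attains {mat2 a b c d, mat2 a' b' c' d'} 1"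
  shows "extremal_pair (mat2 a b c d) (mat2 a' b' c' d')"
proof (rule extremal_pairI)
  have step: "below 1 {(1, 0), (0, 1)} (p, q)" if "p \<ge> 0" "q \<ge> 0" "p + q \<le> 1" for p q
    unfolding below_def using that
    by (intro bexI[of _ "(1, 0)"] bexI[of _ "(0, 1)"] exI[of _ p]) auto
  show "growth_bound {mat2 a b c d, mat2 a' b' c' d'} 1"
    by (rule growth_boundI[where W = "{(1, 0), (0, 1)}" and ?p1.0 = 1 and ?q2.0 = 1]) (use nn le in \<open>auto intro!: step\<close>)
qed (use att in auto)

lemma extremal_pair_ones:
  assumes "a \<in> {0, 1}" "b \<in> {0, 1}" "c \<in> {0, 1}" "d \<in> {0, 1}"
  shows "extremal_pair (mat2 1 1 1 1) (mat2 a b c d)"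
proof (rule extremal_pairI)
  show "attains {mat2 1 1 1 1, mat2 a b c d} 2"
    by (rule attains_word[of "[mat2 1 1 1 1]" 1 1]) auto
  show "growth_bound {mat2 1 1 1 1, mat2 a b c d} 2"
    by (rule growth_boundI[where W = "{(1, 1)}"]) (use assms in \<open>auto intro!: belowI[of 1 1]\<close>)
qed simp

section \<open>Pairs governed by the golden ratio\<close>

definition golden :: real where "golden = (1 + sqrt 5) / 2"

lemma golden_square: "golden * golden = golden + 1"
  by (simp add: golden_def field_simps)

lemma golden_gt_1: "golden > 1"
  using real_less_rsqrt[of 1 5] by (simp add: golden_def)

text \<open>A zero in a column bounds that coordinate of the image by \<open>golden\<close>, the
  other one by \<open>golden + 1 = golden * golden\<close>. This is \<open>golden\<close> times one
  of the two functionals.\<close>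

lemma below_golden:
  assumes bin: "a \<in> {0, 1}" "b \<in> {0, 1}" "c \<in> {0, 1}" "d \<in> {0, 1}"
    and zero: "a = 0 \<or> b = 0 \<or> c = 0 \<or> d = 0" and w: "w \<in> {(golden, 1), (1, golden)}"
  shows "below golden {(golden, 1), (1, golden)} (row_act (mat2 a b c d) w)"
proof -
  note g = golden_gt_1 golden_square
  consider "a = 0 \<or> c = 0" | "b = 0 \<or> d = 0" using zero by blast
  then show ?thesis
  proof cases
    case 1
    then show ?thesis using bin w g by (auto intro!: belowI[of 1 golden])
  next
    case 2
    then show ?thesis using bin w g by (auto intro!: belowI[of golden 1])
  qed
qed

lemma growth_bound_golden:
  assumes "a \<in> {0, 1}" "b \<in> {0, 1}" "c \<in> {0, 1}" "d \<in> {0, 1}"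
    and "a = 0 \<or> b = 0 \<or> c = 0 \<or> d = 0"
    and "a' \<in> {0, 1}" "b' \<in> {0, 1}" "c' \<in> {0, 1}" "d' \<in> {0, 1}"
    and "a' = 0 \<or> b' = 0 \<or> c' = 0 \<or> d' = 0"
  shows "growth_bound {mat2 a b c d, mat2 a' b' c' d'} golden"
proof (rule growth_boundI[where W = "{(golden, 1), (1, golden)}" and ?p1.0 = golden and ?q2.0 = 1])
  fix A w assume "A \<in> {mat2 a b c d, mat2 a' b' c' d'}" and w: "w \<in> {(golden, 1), (1, golden)}"
  then consider "A = mat2 a b c d" | "A = mat2 a' b' c' d'" by blast
  then show "below golden {(golden, 1), (1, golden)} (row_act A w)"
    using below_golden[OF assms(1-5) w] below_golden[OF assms(6-10) w] by cases simp_all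
qed (use golden_gt_1 in auto)

lemma extremal_pair_golden:
  assumes "a \<in> {0, 1}" "b \<in> {0, 1}" "c \<in> {0, 1}" "d \<in> {0, 1}"
    and "a = 0 \<or> b = 0 \<or> c = 0 \<or> d = 0"
  shows "extremal_pair (mat2 1 1 1 0) (mat2 a b c d)"
proof (rule extremal_pairI)
  show "attains {mat2 1 1 1 0, mat2 a b c d} golden"
    by (rule attains_word[of "[mat2 1 1 1 0]" golden 1]) (auto simp: golden_square)
  show "growth_bound {mat2 1 1 1 0, mat2 a b c d} golden"
    by (rule growth_bound_golden) (use assms in auto)
qed (use golden_gt_1 in simp)

text \<open>The product of the two shears is the square of the Fibonacci matrix
  \<open>mat2 1 1 1 0\<close>.\<close>

lemma extremal_pair_shears: "extremal_pair (mat2 1 1 0 1) (mat2 1 0 1 1)"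
proof (rule extremal_pairI)
  have cube: "golden + golden * golden = golden * (golden * golden)"
    using golden_square by (simp add: algebra_simps)
  show "attains {mat2 1 1 0 1, mat2 1 0 1 1} golden"
    by (rule attains_word[of "[mat2 1 1 0 1, mat2 1 0 1 1]" golden 1])
       (use golden_square cube in \<open>auto simp: power2_eq_square\<close>)
  show "growth_bound {mat2 1 1 0 1, mat2 1 0 1 1} golden"
    by (rule growth_bound_golden) auto
qed (use golden_gt_1 in simp)

section \<open>Exceptional pairs with longer optimal words\<close>

lemma extremal_pair_sqrt2: "extremal_pair (mat2 1 1 0 0) (mat2 1 0 1 0)"
proof (rule extremal_pairI)
  \<comment> \<open>Up to the factor \<open>sqrt 2\<close>, the first matrix sends
    \<open>(sqrt 2, 0)\<close> to \<open>(1, 1)\<close> and the second sends it back.\<close>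
  let ?W = "{(1, 1), (sqrt 2, 0)}"
  have s: "sqrt 2 * sqrt 2 = 2" "1 \<le> sqrt 2" "sqrt 2 \<le> 2"
    using real_le_lsqrt[of 2 2] by auto
  show "attains {mat2 1 1 0 0, mat2 1 0 1 0} (sqrt 2)"
    by (rule attains_word[of "[mat2 1 1 0 0, mat2 1 0 1 0]" 1 0]) auto
  have "below (sqrt 2) ?W (1, 1)" "below (sqrt 2) ?W (sqrt 2, sqrt 2)"
    using s by (auto intro: belowI[of 1 1])
  moreover have "below (sqrt 2) ?W (2, 0)" "below (sqrt 2) ?W (sqrt 2, 0)"
    using s by (auto intro!: belowI[of "sqrt 2" 0])
  ultimately show "growth_bound {mat2 1 1 0 0, mat2 1 0 1 0} (sqrt 2)"
    by (intro growth_boundI[where W = ?W and ?p1.0 = 1 and ?q2.0 = 1]) auto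
qed simp

text \<open>With \<open>U\<close> and \<open>L\<close> the two matrices, \<open>U * L^m\<close> has
  eigenvalue \<open>m\<close>, and the root of \<open>m\<close> of order \<open>m + 1\<close> is
  largest at \<open>m = 4\<close>.\<close>

lemma extremal_pair_nilpotent_shear: "extremal_pair (mat2 0 1 0 0) (mat2 1 0 1 1)"
proof (rule extremal_pairI)
  define r where "r = root 5 (4 :: real)"
  let ?U = "mat2 0 1 0 0" and ?L = "mat2 1 0 1 1"
  \<comment> \<open>The images of \<open>(0, 1)\<close> under the powers of \<open>L / r\<close>, scaled by \<open>r ^ 4\<close>; the last one dominates its successor.\<close>
  let ?W = "{(0, r ^ 4), (r ^ 3, r ^ 3), (2 * r\<^sup>2, r\<^sup>2), (3 * r, r), (4, 1)}"
  have r0: "r \<ge> 0" by (simp add: r_def)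
  have r5: "r ^ 5 = 4" by (simp add: r_def)
  \<comment> \<open>The lower bound puts \<open>(5, 1)\<close>, the image of \<open>(4, 1)\<close>
    under \<open>L\<close>, below \<open>r * (4, 1)\<close>. The upper bound gives
    \<open>3 * r \<le> 4\<close>, so that \<open>U\<close> sends every functional below
    \<open>(0, 4)\<close>.\<close>
  have lo: "5 / 4 \<le> r"
    by (rule power_le_imp_le_base[of _ 4]) (use r0 r5 in \<open>auto simp: power_divide\<close>)
  have hi: "r \<le> 4 / 3"
    by (rule power_le_imp_le_base[of _ 4]) (use r5 in \<open>auto simp: power_divide\<close>)
  have pw: "r\<^sup>2 \<le> (4 / 3)\<^sup>2" "r ^ 3 \<le> (4 / 3) ^ 3" using r0 hi by (intro power_mono; simp)+
  have mul: "r * r ^ 4 = 4" "r * r ^ 3 = r ^ 4" "r * r\<^sup>2 = r ^ 3" "r * r = r\<^sup>2"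
    using r5 by (simp_all add: power_numeral_reduce)
  have "r * (r * (r * (r * r))) = 4" using r5 by (simp add: eval_nat_numeral)
  then show "attains {?U, ?L} (root 5 4)"
    unfolding r_def[symmetric]
    by (intro attains_word[of "[?U, ?L, ?L, ?L, ?L]" 1 0]) auto
  have U: "below r ?W (0, p)" if "p \<le> 4" for p
    by (rule belowI[of 0 "r ^ 4"]) (use mul that in auto)
  have L: "below r ?W (r ^ 4, r ^ 4)" "below r ?W (2 * r ^ 3, r ^ 3)"
    "below r ?W (3 * r\<^sup>2, r\<^sup>2)" "below r ?W (4 * r, r)" "below r ?W (5, 1)"
    by (rule belowI[of "r ^ 3" "r ^ 3"] belowI[of "2 * r\<^sup>2" "r\<^sup>2"] belowI[of "3 * r" r]
          belowI[of 4 1]; use mul lo in \<open>simp add: algebra_simps\<close>)+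
  have "below r ?W (row_act A w)" if A: "A \<in> {?U, ?L}" and w: "w \<in> ?W" for A w
  proof (cases "A = ?U")
    case True
    then show ?thesis using w pw hi by (auto intro!: U simp: power_divide)
  next
    case False
    then have "A = ?L" using A by simp
    then show ?thesis using w L by auto
  qed
  then show "growth_bound {?U, ?L} (root 5 4)"
    unfolding r_def[symmetric]
    by (intro growth_boundI[where W = ?W and ?p1.0 = 4 and ?q1.0 = 1 and ?p2.0 = 4 and ?q2.0 = 1]) (use r0 in auto)
qed simp

text \<open>\<open>4 / 3\<close> lets \<open>r * (3, 1)\<close> dominate the image
  \<open>(4, 1)\<close> under the shear, and \<open>3 / 2\<close> gives
  \<open>2 * r \<le> 3\<close>, used for the images under the other matrix.\<close>

lemma cube_root_3_bounds: "4 / 3 \<le> root 3 (3 :: real)" "root 3 (3 :: real) \<le> 3 / 2"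
proof -
  have cube: "root 3 3 ^ 3 = (3 :: real)" by simp
  show "4 / 3 \<le> root 3 (3 :: real)"
    by (rule power_le_imp_le_base[of _ 2]) (use cube in \<open>auto simp: power_divide\<close>)
  show "root 3 (3 :: real) \<le> 3 / 2"
    by (rule power_le_imp_le_base[of _ 2]) (use cube in \<open>auto simp: power_divide\<close>)
qed

text \<open>Here \<open>U * L^m\<close> has eigenvalue \<open>m + 1\<close>, and the root of
  \<open>n\<close> of order \<open>n\<close> is largest among integers at
  \<open>n = 3\<close>.\<close>

lemma extremal_pair_projection_shear: "extremal_pair (mat2 1 1 0 0) (mat2 1 0 1 1)"
proof (rule extremal_pairI)
  define r where "r = root 3 (3 :: real)"
  let ?U = "mat2 1 1 0 0" and ?L = "mat2 1 0 1 1"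
  \<comment> \<open>A cycle under \<open>L\<close>, \<open>L\<close>, \<open>U\<close>, up to the
    factor \<open>r\<close> in each step.\<close>
  let ?W = "{(r\<^sup>2, r\<^sup>2), (2 * r, r), (3, 1)}"
  have r: "4 / 3 \<le> r" "r \<le> 3 / 2" using cube_root_3_bounds by (simp_all add: r_def)
  have r3: "r ^ 3 = 3" by (simp add: r_def)
  have pw: "r\<^sup>2 \<le> (3 / 2)\<^sup>2" using r by (intro power_mono) auto
  have mul: "r * r\<^sup>2 = 3" "r * r = r\<^sup>2" using r3 by (simp_all add: power_numeral_reduce)
  have "r * (r * r) = 3" using r3 by (simp add: eval_nat_numeral)
  then show "attains {?U, ?L} (root 3 3)"
    unfolding r_def[symmetric]
    by (intro attains_word[of "[?U, ?L, ?L]" 1 0]) auto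
  have U: "below r ?W (p, p)" if "p \<le> 3" for p
    by (rule belowI[of "r\<^sup>2" "r\<^sup>2"]) (use mul that in auto)
  have L: "below r ?W (2 * r\<^sup>2, r\<^sup>2)" "below r ?W (3 * r, r)" "below r ?W (4, 1)"
    by (rule belowI[of "2 * r" r] belowI[of 3 1]; use mul r in \<open>simp add: algebra_simps\<close>)+
  have "below r ?W (row_act A w)" if A: "A \<in> {?U, ?L}" and w: "w \<in> ?W" for A w
  proof (cases "A = ?U")
    case True
    then show ?thesis using w pw r by (auto intro!: U simp: power_divide)
  next
    case False
    then have "A = ?L" using A by simp
    then show ?thesis using w L by auto
  qed
  then show "growth_bound {?U, ?L} (root 3 3)"
    unfolding r_def[symmetric]
    by (intro growth_boundI[where W = ?W and ?p1.0 = 3 and ?q1.0 = 1 and ?p2.0 = 3 and ?q2.0 = 1]) (use r in auto)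
qed simp

lemma extremal_pair_projection_shear': "extremal_pair (mat2 0 1 0 1) (mat2 1 0 1 1)"
proof (rule extremal_pairI)
  define r where "r = root 3 (3 :: real)"
  let ?U = "mat2 0 1 0 1" and ?L = "mat2 1 0 1 1"
  \<comment> \<open>The first three functionals form a cycle under \<open>L\<close>,
    \<open>L\<close>, \<open>U\<close> up to the factor \<open>r\<close>. The last one is the image
    of \<open>(2 * r, r)\<close> under \<open>L / r\<close>.\<close>
  let ?W = "{(0, 3), (r\<^sup>2, r\<^sup>2), (2 * r, r), (3, 1)}"
  have r: "4 / 3 \<le> r" "r \<le> 3 / 2" using cube_root_3_bounds by (simp_all add: r_def)
  have r3: "r ^ 3 = 3" by (simp add: r_def)
  have mul: "r * r\<^sup>2 = 3" "r * r = r\<^sup>2" using r3 by (simp_all add: power_numeral_reduce)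
  have pw: "r\<^sup>2 \<le> 3 / 2 * r" using mult_right_mono[OF r(2), of r] r mul by simp
  have "r * (r * r) = 3" using r3 by (simp add: eval_nat_numeral)
  then show "attains {?U, ?L} (root 3 3)"
    unfolding r_def[symmetric]
    by (intro attains_word[of "[?U, ?L, ?L]" 1 1]) auto
  have U: "below r ?W (0, p)" if "p \<le> 3 * r" for p
    by (rule belowI[of 0 3]) (use mul that in auto)
  have L: "below r ?W (3, 3)" "below r ?W (2 * r\<^sup>2, r\<^sup>2)" "below r ?W (3 * r, r)" "below r ?W (4, 1)"
    by (rule belowI[of "r\<^sup>2" "r\<^sup>2"] belowI[of "2 * r" r] belowI[of 3 1];
        use mul r in \<open>simp add: algebra_simps\<close>)+
  have "below r ?W (row_act A w)" if A: "A \<in> {?U, ?L}" and w: "w \<in> ?W" for A w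
  proof (cases "A = ?U")
    case True
    then show ?thesis using w pw r by (auto intro!: U)
  next
    case False
    then have "A = ?L" using A by simp
    then show ?thesis using w L by auto
  qed
  then show "growth_bound {?U, ?L} (root 3 3)"
    unfolding r_def[symmetric]
    by (intro growth_boundI[where W = ?W and ?p1.0 = 3 and ?q1.0 = 1 and ?p2.0 = 3 and ?q2.0 = 1]) (use r in auto)
qed simp

text \<open>\<open>U^k * J\<close> has rows \<open>(k, 1)\<close> and \<open>(1, 0)\<close>, hence
  eigenvalue \<open>(k + sqrt (k^2 + 4)) / 2\<close>. Its root of order \<open>k + 1\<close> is
  largest at \<open>k = 3\<close>.\<close>

lemma extremal_pair_swap_shear: "extremal_pair (mat2 0 1 1 0) (mat2 1 1 0 1)"
proof (rule extremal_pairI)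
  define m where "m = (3 + sqrt 13) / 2"
  define r where "r = root 4 m"
  let ?J = "mat2 0 1 1 0" and ?U = "mat2 1 1 0 1"
  \<comment> \<open>\<open>(m, 1)\<close> is a left eigenvector of \<open>U ^ 3 * J\<close> for \<open>m = r ^ 4\<close>; the functionals are its successive
    images under \<open>U / r\<close>, scaled by \<open>r ^ 3\<close>.\<close>
  let ?W = "{(m * r ^ 3, r ^ 3), (m * r\<^sup>2, (m + 1) * r\<^sup>2), (m * r, (2 * m + 1) * r), (m, 3 * m + 1)}"
  have m2: "m * m = 3 * m + 1" by (simp add: m_def field_simps)
  have m: "3302 / 1000 \<le> m" "m \<le> 3303 / 1000"
    using real_le_rsqrt[of "3604 / 1000" 13] real_le_lsqrt[of "3606 / 1000" 13]
    by (simp_all add: m_def power2_eq_square)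
  have r0: "r \<ge> 0" using m by (simp add: r_def)
  have r4: "r ^ 4 = m" using m by (simp add: r_def)
  have lo: "1348 / 1000 \<le> r"
    by (rule power_le_imp_le_base[of _ 3]) (use r0 r4 m in \<open>auto simp: power_divide\<close>)
  have hi: "r \<le> 135 / 100"
    by (rule power_le_imp_le_base[of _ 3]) (use r4 m in \<open>auto simp: power_divide\<close>)
  have pw: "1817 / 1000 \<le> r\<^sup>2" "2449 / 1000 \<le> r ^ 3"
    using power_mono[OF lo, of 2] power_mono[OF lo, of 3] by (simp_all add: power_divide)
  have r2: "r\<^sup>2 \<le> 182 / 100"
    by (rule power_le_imp_le_base[of _ 1]) (use r4 m in \<open>auto simp: power_divide simp flip: power_mult\<close>)
  have lower: "3302 / 1000 * (1348 / 1000) \<le> m * r" "3302 / 1000 * (2449 / 1000) \<le> m * r ^ 3"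
    using m lo pw by (intro mult_mono; simp)+
  have upper: "m * r \<le> 3303 / 1000 * (135 / 100)" "m * r\<^sup>2 \<le> 3303 / 1000 * (182 / 100)"
    using m hi r2 r0 by (intro mult_mono; simp)+
  note num = m lo hi pw r2 lower upper
  have pow: "r * r ^ 3 = m" "r * r\<^sup>2 = r ^ 3" "r * r = r\<^sup>2"
    using r4 by (simp_all add: power_numeral_reduce)
  \<comment> \<open>With \<open>r ^ 4 = m\<close> and \<open>m * m = 3 * m + 1\<close>, every
    functional multiplied by \<open>r\<close> becomes linear in \<open>m\<close>, the powers of
    \<open>r\<close> and their products with \<open>m\<close>, so numerical enclosures of these
    decide the comparisons.\<close>
  have "r * (c * x) = c * (r * x)" for c x :: real by simp
  then have mul: "r * (m * r ^ 3) = 3 * m + 1" "r * r ^ 3 = m" "r * (m * r\<^sup>2) = m * r ^ 3"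
    "r * ((m + 1) * r\<^sup>2) = m * r ^ 3 + r ^ 3" "r * (m * r) = m * r\<^sup>2"
    "r * ((2 * m + 1) * r) = 2 * (m * r\<^sup>2) + r\<^sup>2" "r * m = m * r" "r * (3 * m + 1) = 3 * (m * r) + r"
    by (simp_all only: pow m2) (simp_all add: algebra_simps)
  have "r * (r * (r * r)) = m" "r * (r * (r * (r * m))) = m * m"
    using r4 by (simp_all add: eval_nat_numeral)
  then show "attains {?J, ?U} r"
    by (intro attains_word[of "[?U, ?U, ?U, ?J]" m 1]) (use m2 in auto)
  have U: "below r ?W (m * r ^ 3, m * r ^ 3 + r ^ 3)"
    "below r ?W (m * r\<^sup>2, m * r\<^sup>2 + (m + 1) * r\<^sup>2)"
    "below r ?W (m * r, m * r + (2 * m + 1) * r)" "below r ?W (m, m + (3 * m + 1))"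
  proof -
    show "below r ?W (m * r ^ 3, m * r ^ 3 + r ^ 3)"
      by (rule belowI[of "m * r\<^sup>2" "(m + 1) * r\<^sup>2"]) (simp_all add: mul)
    show "below r ?W (m * r\<^sup>2, m * r\<^sup>2 + (m + 1) * r\<^sup>2)"
      by (rule belowI[of "m * r" "(2 * m + 1) * r"]) (simp_all add: mul, simp add: algebra_simps)
    show "below r ?W (m * r, m * r + (2 * m + 1) * r)"
      by (rule belowI[of m "3 * m + 1"]) (simp_all add: mul, simp add: algebra_simps)
    \<comment> \<open>The chain of \<open>U\<close>-images stops here: its last member times
      \<open>r\<close> dominates the next image.\<close>
    show "below r ?W (m, m + (3 * m + 1))"
    proof (rule belowI[of m "3 * m + 1"])
      show "m \<le> r * m" "m + (3 * m + 1) \<le> r * (3 * m + 1)"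
        unfolding mul using num by simp_all
    qed simp
  qed
  have J: "below r ?W (r ^ 3, m * r ^ 3)" "below r ?W ((m + 1) * r\<^sup>2, m * r\<^sup>2)"
    "below r ?W ((2 * m + 1) * r, m * r)" "below r ?W (3 * m + 1, m)"
  proof -
    show "below r ?W (r ^ 3, m * r ^ 3)"
    proof (rule belowI[of "m * r\<^sup>2" "(m + 1) * r\<^sup>2"])
      have "1 * r ^ 3 \<le> m * r ^ 3" using m r0 by (intro mult_right_mono) auto
      then show "r ^ 3 \<le> r * (m * r\<^sup>2)" unfolding mul by (simp add: algebra_simps)
    qed (use r0 in \<open>simp_all add: mul\<close>)
    show "below r ?W ((m + 1) * r\<^sup>2, m * r\<^sup>2)"
    proof (rule below_convexI[of "m * r ^ 3" "r ^ 3" _ "m * r\<^sup>2" "(m + 1) * r\<^sup>2" 1 1])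
      have "2 * (m * r\<^sup>2) + 2 * r\<^sup>2 \<le> 3 * m + 1 + m * r ^ 3" using num by linarith
      then show "(1 + 1) * ((m + 1) * r\<^sup>2) \<le> 1 * (r * (m * r ^ 3)) + 1 * (r * (m * r\<^sup>2))"
        unfolding mul by (simp add: algebra_simps)
      have "2 * (m * r\<^sup>2) \<le> m + (m * r ^ 3 + r ^ 3)" using num by linarith
      then show "(1 + 1) * (m * r\<^sup>2) \<le> 1 * (r * r ^ 3) + 1 * (r * ((m + 1) * r\<^sup>2))"
        unfolding mul by (simp add: algebra_simps)
    qed auto
    \<comment> \<open>No single functional times \<open>r\<close> dominates this image. A point on
      the edge between the first two, with weights 5 and 1, does.\<close>
    show "below r ?W ((2 * m + 1) * r, m * r)"
    proof (rule below_convexI[of "m * r ^ 3" "r ^ 3" _ "m * r\<^sup>2" "(m + 1) * r\<^sup>2" 5 1])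
      have "12 * (m * r) + 6 * r \<le> 15 * m + 5 + m * r ^ 3" using num by linarith
      then show "(5 + 1) * ((2 * m + 1) * r) \<le> 5 * (r * (m * r ^ 3)) + 1 * (r * (m * r\<^sup>2))"
        unfolding mul by (simp add: algebra_simps)
      have "6 * (m * r) \<le> 5 * m + (m * r ^ 3 + r ^ 3)" using num by linarith
      then show "(5 + 1) * (m * r) \<le> 5 * (r * r ^ 3) + 1 * (r * ((m + 1) * r\<^sup>2))"
        unfolding mul by (simp add: algebra_simps)
    qed auto
    show "below r ?W (3 * m + 1, m)"
      by (rule belowI[of "m * r ^ 3" "r ^ 3"]) (simp_all add: mul)
  qed
  have "below r ?W (row_act A w)" if A: "A \<in> {?J, ?U}" and w: "w \<in> ?W" for A w
  proof (cases "A = ?U")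
    case True
    then show ?thesis using w U by auto
  next
    case False
    then have "A = ?J" using A by simp
    then show ?thesis using w J by auto
  qed
  then show "growth_bound {?J, ?U} r"
    by (intro growth_boundI[where W = ?W and ?p1.0 = m and ?q1.0 = "3 * m + 1" and ?p2.0 = m
          and ?q2.0 = "3 * m + 1"]) (use r0 m in auto)
  show "r \<ge> 0" by (rule r0)
qed

section \<open>Exhaustion of all pairs\<close>

text \<open>A binary matrix with both off-diagonal entries 1 is all ones, a golden ratio case or the
  swap; every other one is triangular. This leaves the swap against itself or a triangular matrix,
  and an upper against a lower triangular matrix, neither diagonal. \<open>cols\<close>,
  \<open>rows\<close> and \<open>special\<close> with its flips settle these.\<close>

lemma extremal_pair_binary:
  assumes "a \<in> {0, 1}" "b \<in> {0, 1}" "c \<in> {0, 1}" "d \<in> {0, 1}"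
    and "a' \<in> {0, 1}" "b' \<in> {0, 1}" "c' \<in> {0, 1}" "d' \<in> {0, 1}"
  shows "extremal_pair (mat2 a b c d) (mat2 a' b' c' d')"
proof -
  let ?E = "\<lambda>a b c d a' b' c' d'. extremal_pair (mat2 a b c d) (mat2 a' b' c' d')"
  note special = extremal_pair_shears extremal_pair_sqrt2 extremal_pair_nilpotent_shear
    extremal_pair_projection_shear extremal_pair_projection_shear' extremal_pair_swap_shear
  note facts = extremal_pair_ones extremal_pair_golden extremal_pair_golden[THEN extremal_pair_flip]
    extremal_pair_upper extremal_pair_lower special special[THEN extremal_pair_flip]
  note att = attains_one_swap attains_one_nilpotent attains_one_upper[of 1 1 0] attains_one_upper[of 0 1 1]
    attains_one_lower[of 0 1 1] attains_one_lower[of 1 1 0]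
  have cols: "?E 0 1 1 0 0 0 0 0" "?E 0 1 1 0 1 0 0 0" "?E 0 1 1 0 0 0 0 1" "?E 0 1 1 0 1 0 0 1"
    "?E 0 1 1 0 0 1 0 0" "?E 0 1 1 0 0 0 1 0" "?E 0 1 1 0 1 1 0 0" "?E 0 1 1 0 0 0 1 1"
    "?E 0 1 1 0 0 1 1 0" "?E 0 1 0 0 0 0 1 0" "?E 0 1 0 0 0 0 1 1" "?E 1 1 0 0 0 0 1 0" "?E 1 1 0 0 0 0 1 1"
    by (rule extremal_pair_column_sums; (simp; fail)?; rule att; (simp; fail))+
  have rows: "?E 0 1 1 0 0 1 0 1" "?E 0 1 1 0 1 0 1 0" "?E 0 1 0 0 1 0 1 0" "?E 0 1 0 1 0 0 1 0"
    "?E 0 1 0 1 1 0 1 0"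
    by (rule extremal_pair_row_sums; (simp; fail)?; rule att; (simp; fail))+
  note all = facts cols rows
  \<comment> \<open>The bounded quantifiers unfold into 256 closed instances, each matched directly
    or with the two matrices exchanged.\<close>
  have "\<forall>a\<in>{0, 1}. \<forall>b\<in>{0, 1}. \<forall>c\<in>{0, 1}. \<forall>d\<in>{0, 1}.
      \<forall>a'\<in>{0, 1}. \<forall>b'\<in>{0, 1}. \<forall>c'\<in>{0, 1}. \<forall>d'\<in>{0, 1}. ?E a b c d a' b' c' d'"
    by (simp add: all all[THEN extremal_pair_commute])
  then show ?thesis using assms by blast
qed

lemma binary_mats_index:
  assumes "A \<in> binary_mats n" "i < n" "j < n"
  shows "A $$ (i, j) \<in> {0, 1}"
proof -
  have A: "A \<in> carrier_mat n n" "elements_mat A \<subseteq> {0, 1}" using assms by (auto simp: binary_mats_def)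
  then show ?thesis using elements_matI[OF A(1) assms(2,3) refl] by blast
qed

theorem mainTheorem3:
  fixes A\<^sub>0 A\<^sub>1 :: "real mat"
  assumes "A\<^sub>0 \<in> binary_mats 2" and "A\<^sub>1 \<in> binary_mats 2"
  shows "finiteness_property 2 {A\<^sub>0, A\<^sub>1}"
proof (rule finiteness_property_if_extremal)
  have bin: "A $$ (i, j) \<in> {0, 1}" if "A \<in> {A\<^sub>0, A\<^sub>1}" "i < 2" "j < 2" for A i j
    using that assms binary_mats_index by blast
  have c: "A\<^sub>0 \<in> carrier_mat 2 2" "A\<^sub>1 \<in> carrier_mat 2 2" using assms by (auto simp: binary_mats_def)
  show "nonneg_mats {A\<^sub>0, A\<^sub>1}"
    unfolding nonneg_mats_def
  proof (intro conjI ballI allI impI)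
    fix A i j assume "A \<in> {A\<^sub>0, A\<^sub>1}" "i < (2 :: nat)" "j < (2 :: nat)"
    then have "A $$ (i, j) \<in> {0, 1}" by (rule bin)
    then show "A $$ (i, j) \<ge> 0" by auto
  qed (use c in simp)
  let ?std = "\<lambda>A. mat2 (A $$ (0, 0)) (A $$ (0, 1)) (A $$ (1, 0)) (A $$ (1, 1))"
  have "extremal_pair (?std A\<^sub>0) (?std A\<^sub>1)"
    by (rule extremal_pair_binary; rule bin; simp)
  then show "extremal {A\<^sub>0, A\<^sub>1}"
    by (simp only: mat2_eta[OF c(1), symmetric] mat2_eta[OF c(2), symmetric] extremal_pair_def)
qed simp

end
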